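(* Let $n\ge 2$, $\delta\in(0,n/(n-1))$, $A = \delta I + (1-\delta)\mathbf{1}\mathbf{1}^T\in\mathbb{R}^{n\times n}$ and $f(x)=\frac12x^TAx$. Given any $x^0\in\mathbb{R}^n$, let $x^1$ be the iterate obtained after a single iteration of RCD or of RPCD with exact line search started from $x^0$. Then \[ \mathbb{E}_i f(x^1) = \frac12\delta\left(1-\frac{\delta}{n}\right)\|x^0\|^2 + \frac12\delta(1-\delta)\left(1-\frac2n\right)(\mathbf{1}^Tx^0)^2 \le \frac12\delta\|x^0\|^2 + \delta f(x^0), \] where $i$ denotes the (random) coordinate chosen for updating at the first iteration.
   Context: $\mathbf{1} = (1,1,\dots,1)^T \in \mathbb{R}^n$ and $\|\cdot\|$ is the Euclidean norm. A step of coordinate descent with exact line search in coordinate $i$ is $x^{1} = x^0 - (Ax^0)_i e_i$, where $e_i$ is the $i$th standard basis vector (note $A_{ii}=1$). In RCD (randomized coordinate descent) the coordinate $i$ is chosen uniformly at random from $\{1,\dots,n\}$ independently at every iteration; in RPCD (random-permutations cyclic coordinate descent) the coordinates within each epoch of $n$ iterations are taken in the order of a uniformly random permutation of $\{1,\dots,n\}$ drawn at the start of the epoch, so the first coordinate updated is the first entry of that permutation. *)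

theory Defs
  imports "HOL-Probability.Probability" "HOL-Combinatorics.Multiset_Permutations"
begin

text \<open>The vector \<open>1 :: real^'n\<close> is the all-ones vector (the unit of \<open>real^'n\<close> is componentwise),
  whereas \<open>mat 1\<close> is the identity matrix; the product below is the \<open>n \<times> n\<close> matrix of ones.\<close>

definition perm_inv_matrix :: "real \<Rightarrow> real^'n^'n" where
  "perm_inv_matrix \<delta> =
     \<delta> *\<^sub>R mat 1 +
     (1 - \<delta>) *\<^sub>R ((columnvector (1 :: real^'n) :: real^1^'n) ** (rowvector (1 :: real^'n) :: real^'n^1))"

definition quad :: "real^'n^'n \<Rightarrow> real^'n \<Rightarrow> real" where
  "quad A x = (1/2) * (x \<bullet> (A *v x))"

text \<open>The exact line search step has no division by \<open>A $ i $ i\<close> because the diagonal of \<open>A\<close> is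
  normalized to one; \<open>cd_step_exact\<close> confirms that it minimizes \<open>quad A\<close> along coordinate \<open>i\<close>.\<close>

definition cd_step :: "real^'n^'n \<Rightarrow> real^'n \<Rightarrow> 'n \<Rightarrow> real^'n" where
  "cd_step A x i = x - ((A *v x) $ i) *\<^sub>R axis i 1"

definition cd_iterate :: "real^'n^'n \<Rightarrow> real^'n \<Rightarrow> 'n list \<Rightarrow> real^'n" where
  "cd_iterate A x0 is = foldl (cd_step A) x0 is"

text \<open>The following are the laws of the list of the first \<open>k\<close> updated coordinates, for RCD and for RPCD.
  For RPCD an epoch has length \<open>CARD('n) \<ge> 1\<close>, so \<open>k\<close> independently permuted epochs always
  contain the first \<open>k\<close> updates.\<close>

definition rcd_coords :: "nat \<Rightarrow> ('n :: finite) list pmf" where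
  "rcd_coords k = replicate_pmf k (pmf_of_set UNIV)"

definition rpcd_coords :: "nat \<Rightarrow> ('n :: finite) list pmf" where
  "rpcd_coords k =
     map_pmf (\<lambda>epochs. take k (concat epochs))
       (replicate_pmf k (pmf_of_set (permutations_of_set UNIV)))"

lemma perm_inv_matrix_nth:
  "perm_inv_matrix \<delta> $ i $ j = (if i = j then 1 else 1 - \<delta>)"
  by (simp add: perm_inv_matrix_def matrix_matrix_mult_def columnvector_def rowvector_def mat_def)

lemma cd_step_exact:
  fixes A :: "real^'n^'n"
  assumes sym: "transpose A = A" and diag: "A $ i $ i = 1"
  shows "quad A (cd_step A x i) \<le> quad A (x + t *\<^sub>R axis i 1)"
proof -
  have *: "quad A (x + s *\<^sub>R axis i 1) = quad A x + s * (A *v x) $ i + s\<^sup>2 / 2" for s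
  proof -
    have 1: "axis i 1 \<bullet> (A *v y) = (A *v y) $ i" for y
      by (simp add: inner_axis')
    have 2: "x \<bullet> (A *v axis i 1) = (A *v x) $ i"
      using 1[of x] by (metis dot_lmul_matrix inner_commute sym transpose_matrix_vector)
    have 3: "(A *v axis i 1) $ i = 1"
      by (simp add: matrix_vector_mul_component inner_axis diag)
    show ?thesis
      by (simp add: quad_def matrix_vector_right_distrib matrix_vector_mult_scaleR inner_add_left
          inner_add_right 1 2 3 power2_eq_square algebra_simps)
  qed
  define g where "g = (A *v x) $ i"
  have "quad A (cd_step A x i) = quad A x - g\<^sup>2 / 2"
    using *[of "- g"] by (simp add: cd_step_def g_def power2_eq_square)
  also have "\<dots> \<le> quad A x + t * g + t\<^sup>2 / 2"
    using zero_le_power2[of "t + g"] by (simp add: power2_eq_square algebra_simps)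
  also have "\<dots> = quad A (x + t *\<^sub>R axis i 1)"
    by (simp add: * g_def)
  finally show ?thesis .
qed

end

theory Submission
  imports Defs
begin

text \<open>Under both sampling laws the first coordinate is uniform. An exact step in coordinate \<open>i\<close> lowers
  the objective by half the square of the \<open>i\<close>-th gradient entry, so the expected decrease is
  \<open>(norm (A *v x))\<^sup>2 / (2 * n)\<close>. The inequality is immediate for \<open>\<delta> \<le> 1\<close>; for \<open>\<delta> > 1\<close> it follows from
  Cauchy-Schwarz, \<open>(1 \<bullet> x)\<^sup>2 \<le> n * (norm x)\<^sup>2\<close>, and \<open>\<delta> * (n - 1) < n\<close>.\<close>

text \<open>A uniform permutation can be drawn recursively, a uniform first entry followed by a
  uniform permutation of the rest; taking \<open>hd\<close> forgets the second draw.\<close>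

lemma map_hd_pmf_of_set_permutations_of_set:
  assumes "finite A" and "A \<noteq> {}"
  shows "map_pmf hd (pmf_of_set (permutations_of_set A)) = pmf_of_set A"
  using assms
  by (simp add: random_permutation_of_set map_bind_pmf bind_return_pmf bind_return_pmf')

lemma rcd_coords_1: "rcd_coords 1 = map_pmf (\<lambda>i. [i]) (pmf_of_set UNIV)"
  unfolding rcd_coords_def by (rule replicate_pmf_1)

text \<open>For \<open>k = 1\<close> a single epoch is drawn, so only the head of one uniform
  permutation survives.\<close>

lemma rpcd_coords_1:
  "rpcd_coords 1 = (map_pmf (\<lambda>i. [i]) (pmf_of_set UNIV) :: ('n::finite) list pmf)"
proof -
  have "rpcd_coords 1 = map_pmf (take 1) (pmf_of_set (permutations_of_set (UNIV :: 'n set)))"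
    unfolding rpcd_coords_def replicate_pmf_1 by (simp add: pmf.map_comp o_def)
  also have "\<dots> = map_pmf (\<lambda>xs. [hd xs]) (pmf_of_set (permutations_of_set UNIV))"
  proof (intro map_pmf_cong refl)
    fix xs :: "'n list"
    assume "xs \<in> set_pmf (pmf_of_set (permutations_of_set UNIV))"
    \<comment> \<open>\<open>take 1 xs\<close> and \<open>[hd xs]\<close> agree only on nonempty
      lists; types are inhabited, so a permutation of \<open>UNIV\<close> is nonempty.\<close>
    then have "set xs = UNIV"
      by (simp add: permutations_of_setD)
    then have "xs \<noteq> []"
      by auto
    then show "take 1 xs = [hd xs]"
      by (cases xs) auto
  qed
  also have "\<dots> = map_pmf (\<lambda>i. [i]) (map_pmf hd (pmf_of_set (permutations_of_set UNIV)))"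
    by (simp add: pmf.map_comp o_def)
  also have "\<dots> = map_pmf (\<lambda>i. [i]) (pmf_of_set UNIV)"
    by (simp add: map_hd_pmf_of_set_permutations_of_set)
  finally show ?thesis .
qed

lemma perm_inv_matrix_mult:
  "perm_inv_matrix \<delta> *v x = \<delta> *\<^sub>R x + ((1 - \<delta>) * (1 \<bullet> x)) *\<^sub>R 1"
proof -
  \<comment> \<open>The diagonal entry 1 splits as \<delta> + (1 - \<delta>), separating the scaled
    identity from the rank-one part.\<close>
  have "(\<Sum>j\<in>UNIV. (if i = j then 1 else 1 - \<delta>) * x $ j)
      = (\<Sum>j\<in>UNIV. \<delta> * (if i = j then x $ j else 0) + (1 - \<delta>) * x $ j)" for i
    by (intro sum.cong refl) (auto simp: algebra_simps)
  then show ?thesis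
    by (simp add: vec_eq_iff matrix_vector_mult_def perm_inv_matrix_nth sum.distrib
        inner_vec_def flip: sum_distrib_left)
qed

lemma quad_perm_inv_matrix:
  "quad (perm_inv_matrix \<delta>) x = (\<delta> * (norm x)\<^sup>2 + (1 - \<delta>) * (1 \<bullet> x)\<^sup>2) / 2"
  unfolding power2_norm_eq_inner
  by (simp add: quad_def perm_inv_matrix_mult inner_add_right inner_commute[of x 1]
      power2_eq_square)

lemma quad_cd_step_perm_inv_matrix:
  fixes x :: "real^'n" and \<delta> :: real
  defines "A \<equiv> perm_inv_matrix \<delta> :: real^'n^'n"
  shows "quad A (cd_step A x i) = quad A x - ((A *v x) $ i)\<^sup>2 / 2"
proof -
  define g where "g = (A *v x) $ i"
  have g: "g = \<delta> * x $ i + (1 - \<delta>) * (1 \<bullet> x)"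
    by (simp add: g_def A_def perm_inv_matrix_mult)
  have "(norm (x - g *\<^sub>R axis i 1))\<^sup>2 = (norm x)\<^sup>2 - 2 * g * x $ i + g\<^sup>2"
    unfolding power2_norm_eq_inner
    by (simp add: inner_diff_left inner_diff_right inner_axis inner_axis' power2_eq_square
        right_diff_distrib)
  moreover have "1 \<bullet> (x - g *\<^sub>R axis i 1) = 1 \<bullet> x - g"
    by (simp add: inner_diff_right inner_axis)
  \<comment> \<open>The change of the objective is \<open>g\<^sup>2 / 2 - g * (\<delta> * x $ i + (1
    - \<delta>) * (1 \<bullet> x))\<close>. Multiplying the formula for \<open>g\<close> by
    \<open>g\<close> turns the subtracted product into \<open>g\<^sup>2\<close>.\<close>
  ultimately have "quad A (x - g *\<^sub>R axis i 1) = quad A x - g\<^sup>2 / 2"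
    unfolding A_def quad_perm_inv_matrix using arg_cong[OF g, of "(*) g"]
    by (simp only:) (simp add: power2_eq_square field_simps)
  then show ?thesis
    by (simp add: cd_step_def g_def)
qed

lemma norm_perm_inv_matrix_mult_squared:
  fixes x :: "real^'n" and \<delta> :: real
  shows "(norm (perm_inv_matrix \<delta> *v x))\<^sup>2 = \<delta>\<^sup>2 * (norm x)\<^sup>2 +
    (2 * \<delta> * (1 - \<delta>) + CARD('n) * (1 - \<delta>)\<^sup>2) * (1 \<bullet> x)\<^sup>2"
proof -
  have "(1 :: real^'n) \<bullet> 1 = CARD('n)"
    by (simp add: inner_vec_def)
  then show ?thesis
    unfolding perm_inv_matrix_mult power2_norm_eq_inner
    by (simp add: inner_add_left inner_add_right inner_commute[of x 1] power2_eq_square)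
       (simp add: algebra_simps)
qed

text \<open>Averaging the decreases over all coordinates sums the squared gradient entries into the
  squared norm.\<close>

lemma expectation_quad_cd_step_perm_inv_matrix:
  fixes x :: "real^'n" and \<delta> :: real
  defines "A \<equiv> perm_inv_matrix \<delta> :: real^'n^'n"
  shows "measure_pmf.expectation (pmf_of_set UNIV) (\<lambda>i. quad A (cd_step A x i)) =
    quad A x - (norm (A *v x))\<^sup>2 / (2 * CARD('n))"
proof -
  have "(norm (A *v x))\<^sup>2 = (\<Sum>i\<in>UNIV. ((A *v x) $ i)\<^sup>2)"
    unfolding power2_norm_eq_inner by (simp add: inner_vec_def power2_eq_square)
  then show ?thesis
    by (simp add: integral_pmf_of_set quad_cd_step_perm_inv_matrix A_def sum_subtractf
        field_simps flip: sum_divide_distrib)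
qed

theorem theorem3p5:
  fixes \<delta> n :: real and A :: "real^'n^'n" and x0 :: "real^'n"
    and coords :: "nat \<Rightarrow> 'n list pmf"
  assumes "CARD('n) \<ge> 2"
    and "n = real CARD('n)"
    and "0 < \<delta>" and "\<delta> < n / (n - 1)"
    and "A = perm_inv_matrix \<delta>"
    and "coords \<in> {rcd_coords, rpcd_coords}"
  shows "measure_pmf.expectation (coords 1) (\<lambda>is. quad A (cd_iterate A x0 is)) =
           (1/2) * \<delta> * (1 - \<delta> / n) * (norm x0)\<^sup>2 +
           (1/2) * \<delta> * (1 - \<delta>) * (1 - 2 / n) * (1 \<bullet> x0)\<^sup>2
       \<and> (1/2) * \<delta> * (1 - \<delta> / n) * (norm x0)\<^sup>2 +
           (1/2) * \<delta> * (1 - \<delta>) * (1 - 2 / n) * (1 \<bullet> x0)\<^sup>2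
         \<le> (1/2) * \<delta> * (norm x0)\<^sup>2 + \<delta> * quad A x0"
proof
  have n: "n \<ge> 2"
    using assms(1,2) by simp
  have "coords 1 = map_pmf (\<lambda>i. [i]) (pmf_of_set UNIV)"
    using assms(6) rcd_coords_1 rpcd_coords_1 by blast
  then have "measure_pmf.expectation (coords 1) (\<lambda>is. quad A (cd_iterate A x0 is)) =
      quad A x0 - (norm (A *v x0))\<^sup>2 / (2 * n)"
    by (simp add: cd_iterate_def assms(2,5) expectation_quad_cd_step_perm_inv_matrix)
  \<comment> \<open>The coefficient of \<open>(1 \<bullet> x0)\<^sup>2\<close> is (1 - \<delta>)/2
    times \<open>1 - 2 * \<delta> / n - (1 - \<delta>)\<close>, which is
    \<open>\<delta> * (1 - 2 / n)\<close>.\<close>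
  also have "\<dots> = (1/2) * \<delta> * (1 - \<delta> / n) * (norm x0)\<^sup>2 +
           (1/2) * \<delta> * (1 - \<delta>) * (1 - 2 / n) * (1 \<bullet> x0)\<^sup>2"
    using n unfolding assms(5) norm_perm_inv_matrix_mult_squared quad_perm_inv_matrix
      assms(2)[symmetric]
    by (simp add: field_simps power2_eq_square)
  finally show "measure_pmf.expectation (coords 1) (\<lambda>is. quad A (cd_iterate A x0 is)) =
           (1/2) * \<delta> * (1 - \<delta> / n) * (norm x0)\<^sup>2 +
           (1/2) * \<delta> * (1 - \<delta>) * (1 - 2 / n) * (1 \<bullet> x0)\<^sup>2" .

  have "(norm (1 :: real^'n))\<^sup>2 = n"
    by (simp add: power2_norm_eq_inner inner_vec_def assms(2))
  then have cs: "(1 \<bullet> x0)\<^sup>2 \<le> n * (norm x0)\<^sup>2"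
    using Cauchy_Schwarz_ineq[of 1 x0] by (simp add: power2_norm_eq_inner)
  have "\<delta> * (n - 1) < n"
    using assms(4) n by (simp add: field_simps)
  \<comment> \<open>Up to the positive factor \<open>\<delta> / (2 * n)\<close>, this is the gap
    between the two sides of the inequality.\<close>
  have "0 \<le> \<delta> * (n + 1) * (norm x0)\<^sup>2 + 2 * (1 - \<delta>) * (1 \<bullet> x0)\<^sup>2"
  proof (cases "\<delta> \<le> 1")
    case True
    then show ?thesis
      using assms(3) n by simp
  next
    case False
    \<comment> \<open>The coefficient of \<open>(1 \<bullet> x0)\<^sup>2\<close> is now negative, so
      its largest value \<open>n * (norm x0)\<^sup>2\<close> is the worst case. It leaves
      \<open>(norm x0)\<^sup>2\<close> with coefficient \<open>\<delta> * (n + 1) + 2 * n * (1 -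
      \<delta>) = 2 * n - \<delta> * (n - 1)\<close>.\<close>
    then have "2 * (\<delta> - 1) * (1 \<bullet> x0)\<^sup>2 \<le> 2 * (\<delta> - 1) * (n * (norm x0)\<^sup>2)"
      by (intro mult_left_mono cs) simp
    moreover have "0 \<le> (2 * n - \<delta> * (n - 1)) * (norm x0)\<^sup>2"
      using \<open>\<delta> * (n - 1) < n\<close> n by (intro mult_nonneg_nonneg) auto
    ultimately show ?thesis
      by (simp add: algebra_simps)
  qed
  then have "0 \<le> \<delta> / (2 * n) * (\<delta> * (n + 1) * (norm x0)\<^sup>2 + 2 * (1 - \<delta>) * (1 \<bullet> x0)\<^sup>2)"
    using assms(3) n by (intro mult_nonneg_nonneg) auto
  also have "\<dots> = (1/2) * \<delta> * (norm x0)\<^sup>2 + \<delta> * quad A x0 -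
      ((1/2) * \<delta> * (1 - \<delta> / n) * (norm x0)\<^sup>2 +
           (1/2) * \<delta> * (1 - \<delta>) * (1 - 2 / n) * (1 \<bullet> x0)\<^sup>2)"
    using n unfolding assms(5) quad_perm_inv_matrix
    by (simp add: field_simps power2_eq_square)
  finally show "(1/2) * \<delta> * (1 - \<delta> / n) * (norm x0)\<^sup>2 +
           (1/2) * \<delta> * (1 - \<delta>) * (1 - 2 / n) * (1 \<bullet> x0)\<^sup>2
         \<le> (1/2) * \<delta> * (norm x0)\<^sup>2 + \<delta> * quad A x0"
    by simp
qed

end
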